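(* Any strongly regular graph $G=\mathrm{srg}(v,k,\lambda,\mu)$ is stress regular.
   Context: Graphs are finite, undirected and simple. A regular graph $G$ with $v$ vertices and degree $k$ is strongly regular, written $G=\mathrm{srg}(v,k,\lambda,\mu)$, if there exist integers $\lambda$ and $\mu$ such that any two adjacent vertices have $\lambda$ common neighbors and any two (distinct) non-adjacent vertices have $\mu$ common neighbors. A geodesic is a shortest path between two vertices (a path and its reverse are the same geodesic); it passes through a vertex if that vertex is an internal vertex of it. The stress of a vertex is the number of geodesics in $G$ passing through it. A graph is stress regular if all of its vertices have the same stress. *)

theory Defs
  imports "Graph_Theory.Vertex_Walk"
begin

text \<open>
  A finite simple undirected graph is the locale predicate \<open>graph\<close> of Graph\_Theory: a finite
  symmetric digraph without loops and parallel arcs, so that an edge is a pair of opposite arcs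
  and the degree of a vertex is its \<open>out_degree\<close>.
\<close>

definition common_neighbours :: "('a, 'b) pre_digraph \<Rightarrow> 'a \<Rightarrow> 'a \<Rightarrow> 'a set" where
  "common_neighbours G x y = {z \<in> verts G. x \<rightarrow>\<^bsub>G\<^esub> z \<and> y \<rightarrow>\<^bsub>G\<^esub> z}"

text \<open>
  Complete and edgeless graphs are not excluded; for them one of the last two conditions is vacuous.
\<close>

definition srg :: "('a, 'b) pre_digraph \<Rightarrow> nat \<Rightarrow> nat \<Rightarrow> int \<Rightarrow> int \<Rightarrow> bool" where
  "srg G v k l m \<longleftrightarrow>
     graph G \<and> card (verts G) = v \<and>
     (\<forall>x \<in> verts G. out_degree G x = k) \<and>
     (\<forall>x \<in> verts G. \<forall>y \<in> verts G. x \<rightarrow>\<^bsub>G\<^esub> y \<longrightarrow> int (card (common_neighbours G x y)) = l) \<and>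
     (\<forall>x \<in> verts G. \<forall>y \<in> verts G. x \<noteq> y \<and> \<not> x \<rightarrow>\<^bsub>G\<^esub> y \<longrightarrow>
        int (card (common_neighbours G x y)) = m)"

definition geodesic :: "('a, 'b) pre_digraph \<Rightarrow> 'a vwalk \<Rightarrow> bool" where
  "geodesic G p \<longleftrightarrow> vpath p G \<and>
     (\<forall>q. vpath q G \<and> hd q = hd p \<and> last q = last p \<longrightarrow> vwalk_length p \<le> vwalk_length q)"

definition internal_verts :: "'a vwalk \<Rightarrow> 'a set" where
  "internal_verts p = set (butlast (tl p))"

text \<open>
  A \<open>vwalk\<close> has a direction, so an undirected geodesic is counted as the set \<open>{p, rev p}\<close>.
\<close>

definition stress :: "('a, 'b) pre_digraph \<Rightarrow> 'a \<Rightarrow> nat" where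
  "stress G x = card {{p, rev p} | p. geodesic G p \<and> x \<in> internal_verts p}"

definition stress_regular :: "('a, 'b) pre_digraph \<Rightarrow> bool" where
  "stress_regular G \<longleftrightarrow> (\<forall>x \<in> verts G. \<forall>y \<in> verts G. stress G x = stress G y)"

end

theory Submission
  imports Defs
begin

text \<open>
  Write \<open>\<lambda>\<close>, \<open>\<mu>\<close> for the parameters \<open>l\<close>, \<open>m\<close>. A geodesic \<open>a, b, c, \<dots>\<close> with at least two edges
  starts with two distinct non-adjacent vertices \<open>a\<close>, \<open>c\<close> that have the common neighbour \<open>b\<close>, so
  \<open>\<mu> > 0\<close>. But then any two distinct non-adjacent vertices have a common neighbour, so that no
  geodesic has more than two edges (\<open>srg_geodesic_length_le\<close>). The geodesics through \<open>x\<close> are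
  therefore the paths \<open>y, x, z\<close> with \<open>y\<close>, \<open>z\<close> distinct non-adjacent neighbours of \<open>x\<close>. There are
  \<open>k\<close> choices of \<open>y\<close>, and \<open>z\<close> ranges over the neighbours of \<open>x\<close> other than \<open>y\<close> and the \<open>\<lambda>\<close> common
  neighbours of \<open>x\<close> and \<open>y\<close>, so the directed geodesics through \<open>x\<close> number \<open>k (k - 1 - \<lambda>)\<close>,
  whatever \<open>x\<close> is. Each undirected geodesic accounts for two of them (\<open>srg_double_stress\<close>).
\<close>

lemma (in graph) card_neighbours: "card {y. x \<rightarrow>\<^bsub>G\<^esub> y} = out_degree G x"
proof -
  have "bij_betw (head G) (out_arcs G x) {y. x \<rightarrow>\<^bsub>G\<^esub> y}"
    unfolding bij_betw_def
  proof
    show "inj_on (head G) (out_arcs G x)"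
      by (rule inj_onI) (auto intro!: no_multi_arcs simp: arc_to_ends_def)
    show "head G ` out_arcs G x = {y. x \<rightarrow>\<^bsub>G\<^esub> y}"
      by (force simp: arcs_ends_conv image_iff)
  qed
  from bij_betw_same_card[OF this] show ?thesis
    by (simp add: out_degree_def)
qed

lemma (in graph) geodesic_two_edges_iff:
  "geodesic G [y, x, z] \<longleftrightarrow> y \<rightarrow>\<^bsub>G\<^esub> x \<and> x \<rightarrow>\<^bsub>G\<^esub> z \<and> y \<noteq> z \<and> \<not> y \<rightarrow>\<^bsub>G\<^esub> z" (is "?L \<longleftrightarrow> ?R")
proof
  assume L: ?L
  then have path: "y \<rightarrow>\<^bsub>G\<^esub> x" "x \<rightarrow>\<^bsub>G\<^esub> z" "y \<noteq> z"
    by (auto simp: geodesic_def vpath_def vwalk_def)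
  have "\<not> y \<rightarrow>\<^bsub>G\<^esub> z"
  proof
    assume "y \<rightarrow>\<^bsub>G\<^esub> z"
    with path have "vpath [y, z] G"
      by (auto simp: vpath_def vwalk_def)
    with L show False
      by (force simp: geodesic_def)
  qed
  with path show ?R by simp
next
  assume R: ?R
  then have "vpath [y, x, z] G"
    by (auto simp: vpath_def vwalk_def dest: adj_not_same)
  moreover have "3 \<le> length q" if "vpath q G" "hd q = y" "last q = z" for q
  proof (rule ccontr)
    assume "\<not> 3 \<le> length q"
    then have "length q = 0 \<or> length q = 1 \<or> length q = 2" by linarith
    with that R show False
      by (auto simp: vpath_def vwalk_def length_Suc_conv numeral_2_eq_2)
  qed
  ultimately show ?L
    unfolding geodesic_def by fastforce
qed

text \<open>Otherwise the path could be shortened by skipping its second vertex.\<close>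
lemma geodesic_second_successor_not_adjacent:
  assumes "geodesic G (a # b # c # r)"
  shows "\<not> a \<rightarrow>\<^bsub>G\<^esub> c"
proof
  assume "a \<rightarrow>\<^bsub>G\<^esub> c"
  with assms have "vpath (a # c # r) G"
    by (auto simp: geodesic_def vpath_def vwalk_def)
  with assms show False
    by (force simp: geodesic_def)
qed

text \<open>
  The parameter \<open>\<mu>\<close> is positive as soon as one geodesic has two edges, and then the ends of a longer
  one would be joined by a path through a common neighbour.
\<close>
lemma srg_geodesic_length_le:
  assumes "srg G v k l m" and geo: "geodesic G p"
  shows "length p \<le> 3"
proof (rule ccontr)
  assume "\<not> length p \<le> 3"
  then obtain a b c d r where p: "p = a # b # c # d # r"
    by (auto simp: not_le numeral_3_eq_3 Suc_le_length_iff less_eq_Suc_le)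
  interpret graph G using assms(1) by (simp add: srg_def)
  have nonadj: "int (card (common_neighbours G x y)) = m"
    if "x \<in> verts G" "y \<in> verts G" "x \<noteq> y" "\<not> x \<rightarrow>\<^bsub>G\<^esub> y" for x y
    using assms(1) that by (simp add: srg_def)
  have path: "a \<in> verts G" "c \<in> verts G" "b \<in> verts G" "a \<noteq> c" "a \<rightarrow>\<^bsub>G\<^esub> b" "b \<rightarrow>\<^bsub>G\<^esub> c"
    using geo by (auto simp: p geodesic_def vpath_def vwalk_def)
  have "\<not> a \<rightarrow>\<^bsub>G\<^esub> c"
    using geo geodesic_second_successor_not_adjacent unfolding p by fast
  then have m: "int (card (common_neighbours G a c)) = m"
    using nonadj path by simp
  have "b \<in> common_neighbours G a c"
    using path arcs_ends_symmetric[OF sym_arcs] by (simp add: common_neighbours_def)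
  moreover have "finite (common_neighbours G a c)"
    by (simp add: common_neighbours_def)
  ultimately have "m > 0"
    using m card_gt_0_iff by fastforce
  define z where "z = last p"
  have z: "z \<in> verts G" "a \<noteq> z"
    using geo by (auto simp: z_def p geodesic_def vpath_def vwalk_def)
  have min: "3 < length q" if "vpath q G" "hd q = a" "last q = z" for q
    using geo that by (force simp: geodesic_def p z_def)
  have "\<not> a \<rightarrow>\<^bsub>G\<^esub> z"
  proof
    assume "a \<rightarrow>\<^bsub>G\<^esub> z"
    with z path have "vpath [a, z] G"
      by (auto simp: vpath_def vwalk_def)
    from min[OF this] show False by simp
  qed
  with \<open>m > 0\<close> z path have "common_neighbours G a z \<noteq> {}"
    using nonadj[of a z] by auto
  then obtain w where "a \<rightarrow>\<^bsub>G\<^esub> w" "w \<rightarrow>\<^bsub>G\<^esub> z"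
    using arcs_ends_symmetric[OF sym_arcs] by (auto simp: common_neighbours_def)
  then have "geodesic G [a, w, z]"
    using z \<open>\<not> a \<rightarrow>\<^bsub>G\<^esub> z\<close> by (simp add: geodesic_two_edges_iff)
  then have "vpath [a, w, z] G"
    by (simp add: geodesic_def)
  from min[OF this] show False by simp
qed

lemma srg_geodesic_through_iff:
  assumes "srg G v k l m"
  shows "geodesic G p \<and> x \<in> internal_verts p \<longleftrightarrow>
    (\<exists>y z. p = [y, x, z] \<and> x \<rightarrow>\<^bsub>G\<^esub> y \<and> x \<rightarrow>\<^bsub>G\<^esub> z \<and> y \<noteq> z \<and> \<not> y \<rightarrow>\<^bsub>G\<^esub> z)" (is "?L \<longleftrightarrow> ?R")
proof
  interpret graph G using assms by (simp add: srg_def)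
  {
    assume L: ?L
    then obtain a b c r where p: "p = a # b # c # r"
      unfolding internal_verts_def
      by (metis butlast.simps empty_iff list.exhaust list.sel(2,3) list.set(1))
    moreover from L have "length p \<le> 3"
      using srg_geodesic_length_le[OF assms] by blast
    ultimately have "r = []" "b = x"
      using L by (auto simp: internal_verts_def)
    with L p show ?R
      using arcs_ends_symmetric[OF sym_arcs] by (auto simp: geodesic_two_edges_iff)
  next
    assume ?R
    then show ?L
      using arcs_ends_symmetric[OF sym_arcs] by (auto simp: geodesic_two_edges_iff internal_verts_def)
  }
qed

text \<open>The pairs \<open>{p, rev p}\<close> partition a reversal-closed set into blocks of size two.\<close>
lemma card_unordered_reversal_pairs:
  assumes "finite P" and "\<And>p. p \<in> P \<Longrightarrow> rev p \<in> P" and "\<And>p. p \<in> P \<Longrightarrow> rev p \<noteq> p"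
  shows "2 * card {{p, rev p} | p. p \<in> P} = card P"
proof -
  let ?C = "{{p, rev p} | p. p \<in> P}"
  have U: "\<Union>?C = P"
    using assms(2) by auto
  have C: "?C = (\<lambda>p. {p, rev p}) ` P"
    by auto
  have "2 * card ?C = card (\<Union>?C)"
  proof (rule card_partition)
    show "finite ?C"
      unfolding C using assms(1) by simp
    show "finite (\<Union>?C)"
      unfolding U by (rule assms(1))
    show "card c = 2" if "c \<in> ?C" for c
    proof -
      from that obtain p where "p \<in> P" "c = {p, rev p}" by blast
      with assms(3)[of p] show ?thesis by simp
    qed
    show "c1 \<inter> c2 = {}" if "c1 \<in> ?C" "c2 \<in> ?C" "c1 \<noteq> c2" for c1 c2
      using that by (auto simp: insert_commute)
  qed
  with U show ?thesis by simp
qed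

text \<open>
  Choosing \<open>y\<close> and then \<open>z\<close> counts the paths \<open>y, x, z\<close>. The truncations in the formula are harmless:
  if \<open>k > 0\<close>, then \<open>l\<close> counts common neighbours and \<open>l + 1 \<le> k\<close>; if \<open>k = 0\<close>, then \<open>l\<close> is
  arbitrary, but the product vanishes.
\<close>
lemma srg_double_stress:
  assumes "srg G v k l m" and "x \<in> verts G"
  shows "2 * stress G x = k * (k - Suc (nat l))"
proof -
  interpret graph G using assms(1) by (simp add: srg_def)
  let ?N = "{y. x \<rightarrow>\<^bsub>G\<^esub> y}"
  let ?M = "\<lambda>y. {z. x \<rightarrow>\<^bsub>G\<^esub> z \<and> y \<noteq> z \<and> \<not> y \<rightarrow>\<^bsub>G\<^esub> z}"
  let ?P = "{p. geodesic G p \<and> x \<in> internal_verts p}"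
  have degree: "card ?N = k"
    using assms card_neighbours by (simp add: srg_def)
  have fin: "finite ?N"
    by (rule finite_subset[OF _ finite_verts]) auto
  have P: "?P = (\<lambda>(y, z). [y, x, z]) ` Sigma ?N ?M"
    by (auto simp: srg_geodesic_through_iff[OF assms(1)])
  have "card (?M y) = k - Suc (nat l)" if y: "y \<in> ?N" for y
  proof -
    have sub: "insert y (common_neighbours G x y) \<subseteq> ?N"
      using y by (auto simp: common_neighbours_def)
    have "y \<notin> common_neighbours G x y"
      using adj_not_same by (auto simp: common_neighbours_def)
    moreover have "finite (common_neighbours G x y)"
      by (simp add: common_neighbours_def)
    moreover have "card (common_neighbours G x y) = nat l"
    proof -
      have "int (card (common_neighbours G x y)) = l"
        using assms y adj_in_verts by (simp add: srg_def)
      then show ?thesis by linarith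
    qed
    moreover have "?M y = ?N - insert y (common_neighbours G x y)"
      by (auto simp: common_neighbours_def)
    ultimately show ?thesis
      using card_Diff_subset[OF _ sub] degree by simp
  qed
  moreover have "finite (?M y)" for y
    by (rule finite_subset[OF _ fin]) auto
  ultimately have "card (Sigma ?N ?M) = k * (k - Suc (nat l))"
    using fin degree by simp
  moreover have "card ?P = card (Sigma ?N ?M)"
    unfolding P by (rule card_image) (auto simp: inj_on_def)
  moreover have "2 * card {{p, rev p} | p. p \<in> ?P} = card ?P"
  proof (rule card_unordered_reversal_pairs)
    show "finite ?P"
      unfolding P using fin \<open>\<And>y. finite (?M y)\<close> by simp
    show "rev p \<in> ?P" "rev p \<noteq> p" if "p \<in> ?P" for p
      using that arcs_ends_symmetric[OF sym_arcs] by (auto simp: srg_geodesic_through_iff[OF assms(1)])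
  qed
  ultimately show ?thesis
    by (simp add: stress_def)
qed

theorem corollary5p4:
  fixes G :: "('a, 'b) pre_digraph" and v k :: nat and l m :: int
  assumes "srg G v k l m"
  shows "stress_regular G"
  unfolding stress_regular_def
proof (intro ballI)
  fix x y assume "x \<in> verts G" "y \<in> verts G"
  then have "2 * stress G x = 2 * stress G y"
    using srg_double_stress[OF assms] by simp
  then show "stress G x = stress G y" by simp
qed

end
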